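(* Let $r>\frac23$, $D>0$, $\mu\in\mathbb{R}$, $c<u_b(r)$ be fixed and consider the system $$\dot q=s,\qquad \dot s=\frac{1}{D}\big((u+\mu)s-f(q,u;r)\big),\qquad \dot u=\frac{\epsilon}{u-c}\,g(q,u)$$ with $f(q,u;r)=q\big(r+u-2-(r+0.1)(q-1)^2\big)$, $g(q,u)=2-u+2q(1-u)$, and its equilibria $X_1=(0,0,2)$, $X_2=(q_{b,+}(r),0,u_b(r))$. Then for $\epsilon>0$ sufficiently small and $k\in\{1,2\}$: (1) the stable manifold $W^s(X_k)$ has dimension $2$ and the unstable manifold $W^u(X_k)$ has dimension $1$; (2) the eigenvalues $\lambda_1^\epsilon(X_k),\lambda_2^\epsilon(X_k),\lambda_3^\epsilon(X_k)$ of the linearization at $X_k$ are real and satisfy (a) $\lambda_1^\epsilon(X_k)<\lambda_2^\epsilon(X_k)<0<\lambda_3^\epsilon(X_k)$, (b) $-\lambda_2^\epsilon(X_k)<\lambda_3^\epsilon(X_k)$, and (c) all three are simple eigenvalues.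
   Context: For $r>\frac23$, $u_b(r)\in(\frac65,\frac43)$ denotes the unique value of $u$ in $(\frac65,\frac43)$ such that, with $q_{b,+}(r)=1+\sqrt{\frac{r+u_b(r)-2}{r+0.1}}>1$, one has $g(q_{b,+}(r),u_b(r))=0$. The system is the traveling-wave ODE of the Barkley pipe-flow model, with $\mu=-(\zeta+c)$, $c$ the wave speed. *)

theory Defs
  imports "HOL-Analysis.Analysis"
begin

text \<open>Nonlinearities of the Barkley pipe-flow traveling-wave ODE.\<close>

definition f_B :: "real \<Rightarrow> real \<Rightarrow> real \<Rightarrow> real" where
  "f_B q u r = q * (r + u - 2 - (r + 0.1) * (q - 1)^2)"

definition g_B :: "real \<Rightarrow> real \<Rightarrow> real" where
  "g_B q u = 2 - u + 2 * q * (1 - u)"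

text \<open>q_{b,+} as a function of r and u (used with u = u_b(r)).\<close>
definition qplus :: "real \<Rightarrow> real \<Rightarrow> real" where
  "qplus r u = 1 + sqrt ((r + u - 2) / (r + 0.1))"

text \<open>u_b(r): the unique u in (6/5,4/3) with g(q_{b,+}(r),u)=0.\<close>
definition u_b :: "real \<Rightarrow> real" where
  "u_b r = (THE u. 6/5 < u \<and> u < 4/3 \<and> g_B (qplus r u) u = 0)"

definition q_bp :: "real \<Rightarrow> real" where
  "q_bp r = qplus r (u_b r)"

text \<open>Points of R^3 with coordinates (q,s,u).\<close>
definition vec3 :: "real \<Rightarrow> real \<Rightarrow> real \<Rightarrow> real^3" where
  "vec3 a b d = (\<chi> i. if i = 1 then a else if i = 2 then b else d)"

text \<open>The vector field: q' = s, s' = ((u+mu) s - f(q,u;r))/D, u' = eps/(u-c) g(q,u).\<close>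
definition barkley_field ::
  "real \<Rightarrow> real \<Rightarrow> real \<Rightarrow> real \<Rightarrow> real \<Rightarrow> real^3 \<Rightarrow> real^3" where
  "barkley_field r D mu c eps X =
     vec3 (X$2)
          (((X$3 + mu) * X$2 - f_B (X$1) (X$3) r) / D)
          (eps / (X$3 - c) * g_B (X$1) (X$3))"

definition X1 :: "real^3" where "X1 = vec3 0 0 2"

definition X2 :: "real \<Rightarrow> real^3" where "X2 r = vec3 (q_bp r) 0 (u_b r)"

text \<open>Stable / unstable subspaces of a linear vector field L (the tangent spaces
  of the stable / unstable manifolds at the equilibrium): initial values of
  solutions of x' = L x tending to 0 as t \<rightarrow> +\<infinity> (resp. -\<infinity>).\<close>
definition stable_subspace :: "(real^3 \<Rightarrow> real^3) \<Rightarrow> (real^3) set" where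
  "stable_subspace L = {v. \<exists>x. x 0 = v \<and> (\<forall>t. (x has_vector_derivative L (x t)) (at t))
                               \<and> (x \<longlongrightarrow> 0) at_top}"

definition unstable_subspace :: "(real^3 \<Rightarrow> real^3) \<Rightarrow> (real^3) set" where
  "unstable_subspace L = {v. \<exists>x. x 0 = v \<and> (\<forall>t. (x has_vector_derivative L (x t)) (at t))
                               \<and> (x \<longlongrightarrow> 0) at_bot}"

end

theory Submission
  imports Defs "HOL-Real_Asymp.Real_Asymp"
begin

text \<open>At an equilibrium (q, 0, u) the Jacobian has characteristic polynomial
  p(z) = (z - be)(z^2 - m z - a) + b al with a > 0, b \<ge> 0 and slow entries al, be < 0 of order eps.
  For eps = 0 it is z (z^2 - m z - a), which is positive at -t and negative at t for small t > 0;
  both signs persist for small eps, while p(0) = a be + b al < 0. Hence there are three real roots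
  l1 < -t < l2 < 0 < t < l3, and in particular -l2 < l3.
  Along a solution of x' = A x the component w \<bullet> x of a left eigenvector w for l evolves as
  exp(l t) (w \<bullet> x(0)). So the stable set contains the eigenvectors for l1, l2 and is orthogonal
  to the left eigenvector for l3, and symmetrically for the unstable set, which fixes the
  dimensions 2 and 1.\<close>

lemma scalar_linear_ode_solution:
  fixes y :: "real \<Rightarrow> real"
  assumes "\<And>t. (y has_real_derivative l * y t) (at t)"
  shows "y t = exp (l * t) * y 0"
proof -
  define h where "h t = exp (- (l * t)) * y t" for t
  have "(h has_real_derivative 0) (at t)" for t
    unfolding h_def by (rule derivative_eq_intros assms refl | simp)+
  then have "h t = h 0"
    by (intro DERIV_isconst_all) blast
  then show ?thesis
    unfolding h_def
    by (simp add: exp_minus field_simps)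
qed

lemma left_eigencomponent_of_linear_ode:
  fixes x :: "real \<Rightarrow> 'a::real_inner"
  assumes "\<forall>t. (x has_vector_derivative L (x t)) (at t)"
    and "\<And>z. w \<bullet> L z = l * (w \<bullet> z)"
  shows "w \<bullet> x t = exp (l * t) * (w \<bullet> x 0)"
proof (rule scalar_linear_ode_solution)
  fix t
  have "((\<lambda>t. w \<bullet> x t) has_vector_derivative w \<bullet> L (x t)) (at t)"
    using assms(1) by (intro bounded_linear.has_vector_derivative[OF bounded_linear_inner_right]) auto
  then show "((\<lambda>t. w \<bullet> x t) has_real_derivative l * (w \<bullet> x t)) (at t)"
    by (simp add: assms(2) has_real_derivative_iff_has_vector_derivative)
qed

lemma stable_subspace_orthogonal_left_eigenvector:
  assumes "v \<in> stable_subspace L" "\<And>z. w \<bullet> L z = l * (w \<bullet> z)" "l > 0"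
  shows "w \<bullet> v = 0"
proof -
  obtain x where x: "x 0 = v" "\<forall>t. (x has_vector_derivative L (x t)) (at t)" "(x \<longlongrightarrow> 0) at_top"
    using assms(1) unfolding stable_subspace_def by blast
  have "w \<bullet> v = exp (- (l * t)) * (w \<bullet> x t)" for t
    using left_eigencomponent_of_linear_ode[OF x(2) assms(2)] x(1) by (simp add: exp_minus)
  moreover have "((\<lambda>t. exp (- (l * t)) * (w \<bullet> x t)) \<longlongrightarrow> 0 * (w \<bullet> 0)) at_top"
    using assms(3) by (intro tendsto_intros x(3)) real_asymp
  ultimately show ?thesis
    by (simp add: tendsto_const_iff)
qed

lemma unstable_subspace_orthogonal_left_eigenvector:
  assumes "v \<in> unstable_subspace L" "\<And>z. w \<bullet> L z = l * (w \<bullet> z)" "l < 0"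
  shows "w \<bullet> v = 0"
proof -
  obtain x where x: "x 0 = v" "\<forall>t. (x has_vector_derivative L (x t)) (at t)" "(x \<longlongrightarrow> 0) at_bot"
    using assms(1) unfolding unstable_subspace_def by blast
  have "w \<bullet> v = exp (- (l * t)) * (w \<bullet> x t)" for t
    using left_eigencomponent_of_linear_ode[OF x(2) assms(2)] x(1) by (simp add: exp_minus)
  moreover have "((\<lambda>t. exp (- (l * t)) * (w \<bullet> x t)) \<longlongrightarrow> 0 * (w \<bullet> 0)) at_bot"
    using assms(3) by (intro tendsto_intros x(3)) real_asymp
  ultimately show ?thesis
    by (simp add: tendsto_const_iff)
qed

lemma eigenvector_exp_solution:
  assumes "linear L" "L v = l *\<^sub>R v"
  shows "((\<lambda>t. exp (l * t) *\<^sub>R v) has_vector_derivative L (exp (l * t) *\<^sub>R v)) (at t)"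
  using assms by (auto intro!: derivative_eq_intros simp: linear_scale)

lemma eigenvector_mem_stable_subspace:
  assumes "linear L" "L v = l *\<^sub>R v" "l < 0"
  shows "v \<in> stable_subspace L"
proof -
  have "((\<lambda>t. exp (l * t)) \<longlongrightarrow> 0) at_top"
    using assms(3) by real_asymp
  from tendsto_scaleR[OF this tendsto_const[of v]]
  show ?thesis
    unfolding stable_subspace_def using eigenvector_exp_solution[OF assms(1,2)]
    by (intro CollectI exI[of _ "\<lambda>t. exp (l * t) *\<^sub>R v"]) simp
qed

lemma eigenvector_mem_unstable_subspace:
  assumes "linear L" "L v = l *\<^sub>R v" "l > 0"
  shows "v \<in> unstable_subspace L"
proof -
  have "((\<lambda>t. exp (l * t)) \<longlongrightarrow> 0) at_bot"
    using assms(3) by real_asymp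
  from tendsto_scaleR[OF this tendsto_const[of v]]
  show ?thesis
    unfolding unstable_subspace_def using eigenvector_exp_solution[OF assms(1,2)]
    by (intro CollectI exI[of _ "\<lambda>t. exp (l * t) *\<^sub>R v"]) simp
qed

lemma eigenvector_of_det_eq_0:
  fixes A :: "real^'n^'n"
  assumes "det (mat l - A) = 0"
  obtains v where "v \<noteq> 0" "A *v v = l *\<^sub>R v"
proof -
  have "\<not> inj ((*v) (mat l - A))"
    using det_nz_iff_inj[of "(*v) (mat l - A)"] assms by simp
  then obtain v where "v \<noteq> 0" "(mat l - A) *v v = 0"
    using linear_inj_iff_eq_0[of "(*v) (mat l - A)"] by auto
  moreover have "mat l *v v = l *\<^sub>R v"
    by (simp add: vec_eq_iff matrix_vector_mult_def mat_def if_distrib[of "\<lambda>x. x * _"] cong: if_cong)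
  ultimately show ?thesis
    using that by (simp add: matrix_vector_mult_diff_rdistrib)
qed

lemma independent_eigenvectors_pair:
  assumes "linear L" "L u = a *\<^sub>R u" "L v = b *\<^sub>R v" "a \<noteq> b" "u \<noteq> 0" "v \<noteq> 0"
  shows "independent {u, v}" "card {u, v} = 2"
proof -
  have "u \<notin> span {v}"
  proof
    assume "u \<in> span {v}"
    then obtain k where k: "u = k *\<^sub>R v"
      by (auto simp: span_singleton)
    then have "a *\<^sub>R u = b *\<^sub>R u"
      using assms(1-3) by (auto simp: linear_scale)
    then show False
      using assms(4,5) by simp
  qed
  moreover have "u \<noteq> v"
    using calculation span_base[of v "{v}"] by blast
  ultimately show "independent {u, v}" "card {u, v} = 2"
    using assms(6) by (auto simp: independent_insert)
qed

lemma dim_add_card_le_orthogonal: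
  fixes W :: "'a::euclidean_space set"
  assumes "independent W" "\<And>x w. x \<in> S \<Longrightarrow> w \<in> W \<Longrightarrow> w \<bullet> x = 0"
  shows "dim S + card W \<le> DIM('a)"
proof -
  let ?C = "{y \<in> UNIV. \<forall>x \<in> span W. orthogonal x y}"
  have "S \<subseteq> ?C"
    using assms(2) orthogonal_to_span by (fastforce simp: orthogonal_def inner_commute)
  then have "dim S \<le> dim ?C"
    by (rule dim_subset)
  moreover have "dim ?C + dim (span W) = DIM('a)"
    using dim_subspace_orthogonal_to_vectors[of "span W" UNIV] by simp
  ultimately show ?thesis
    using dim_eq_card_independent[OF assms(1)] by simp
qed

lemma dim_stable_unstable_subspace_of_spectrum:
  fixes A :: "real^3^3"
  assumes charpoly: "\<And>z. det (mat z - A) = (z - l1) * (z - l2) * (z - l3)"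
    and l: "l1 < l2" "l2 < 0" "0 < l3"
  shows "dim (stable_subspace ((*v) A)) = 2 \<and> dim (unstable_subspace ((*v) A)) = 1"
proof -
  have root: "det (mat l - A) = 0" "det (mat l - transpose A) = 0" if "l \<in> {l1, l2, l3}" for l
  proof -
    show "det (mat l - A) = 0"
      using that by (auto simp: charpoly)
    moreover have "mat l - transpose A = transpose (mat l - A)"
      by (simp add: transpose_def mat_def vec_eq_iff)
    ultimately show "det (mat l - transpose A) = 0"
      by simp
  qed
  obtain v1 v2 v3 where v: "v1 \<noteq> 0" "v2 \<noteq> 0" "v3 \<noteq> 0"
    "A *v v1 = l1 *\<^sub>R v1" "A *v v2 = l2 *\<^sub>R v2" "A *v v3 = l3 *\<^sub>R v3"
    using root(1) eigenvector_of_det_eq_0 by (metis insertCI)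
  obtain w1 w2 w3 where w: "w1 \<noteq> 0" "w2 \<noteq> 0" "w3 \<noteq> 0"
    "transpose A *v w1 = l1 *\<^sub>R w1" "transpose A *v w2 = l2 *\<^sub>R w2" "transpose A *v w3 = l3 *\<^sub>R w3"
    using root(2) eigenvector_of_det_eq_0 by (metis insertCI)
  have left: "w \<bullet> (A *v x) = l * (w \<bullet> x)" if "transpose A *v w = l *\<^sub>R w" for w l x
    using that dot_lmul_matrix[of w A x] by simp
  have lin: "linear ((*v) A)" "linear ((*v) (transpose A))"
    by (simp_all add: matrix_vector_mul_linear)
  have v12: "independent {v1, v2}" "card {v1, v2} = 2"
    using independent_eigenvectors_pair[OF lin(1) v(4,5) _ v(1,2)] l by auto
  have w12: "independent {w1, w2}" "card {w1, w2} = 2"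
    using independent_eigenvectors_pair[OF lin(2) w(4,5) _ w(1,2)] l by auto
  have "{v1, v2} \<subseteq> stable_subspace ((*v) A)"
    using eigenvector_mem_stable_subspace[OF lin(1)] v l by auto
  then have "2 \<le> dim (stable_subspace ((*v) A))"
    using dim_subset dim_eq_card_independent[OF v12(1)] v12(2) by metis
  have "w3 \<bullet> x = 0" if "x \<in> stable_subspace ((*v) A)" for x
    using stable_subspace_orthogonal_left_eigenvector[OF that left[OF w(6)] l(3)] .
  then have "dim (stable_subspace ((*v) A)) + 1 \<le> 3"
    using dim_add_card_le_orthogonal[of "{w3}" "stable_subspace ((*v) A)"] w(3) by simp
  have "{v3} \<subseteq> unstable_subspace ((*v) A)"
    using eigenvector_mem_unstable_subspace[OF lin(1) v(6) l(3)] by simp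
  then have "1 \<le> dim (unstable_subspace ((*v) A))"
    using dim_subset[of "{v3}"] v(3) by simp
  have "w \<bullet> x = 0" if "x \<in> unstable_subspace ((*v) A)" "w \<in> {w1, w2}" for x w
    using unstable_subspace_orthogonal_left_eigenvector[OF that(1) left[OF w(4)]]
      unstable_subspace_orthogonal_left_eigenvector[OF that(1) left[OF w(5)]] l that(2) by auto
  then have "dim (unstable_subspace ((*v) A)) + 2 \<le> 3"
    using dim_add_card_le_orthogonal[of "{w1, w2}" "unstable_subspace ((*v) A)"] w12 by simp
  show ?thesis
    using \<open>2 \<le> dim (stable_subspace ((*v) A))\<close> \<open>dim (stable_subspace ((*v) A)) + 1 \<le> 3\<close>
      \<open>1 \<le> dim (unstable_subspace ((*v) A))\<close> \<open>dim (unstable_subspace ((*v) A)) + 2 \<le> 3\<close>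
    by linarith
qed

lemma monic_cubic_eq_prod_of_roots:
  fixes A B C l1 l2 l3 :: real
  assumes r1: "l1^3 + A*l1^2 + B*l1 + C = 0" and r2: "l2^3 + A*l2^2 + B*l2 + C = 0"
    and r3: "l3^3 + A*l3^2 + B*l3 + C = 0"
    and d: "l1 \<noteq> l2" "l1 \<noteq> l3" "l2 \<noteq> l3"
  shows "z^3 + A*z^2 + B*z + C = (z - l1) * (z - l2) * (z - l3)"
proof -
  have "(l1 - l2) * (l1^2 + l1*l2 + l2^2 + A*(l1 + l2) + B) = 0"
    using r1 r2 by (simp add: algebra_simps power2_eq_square power3_eq_cube)
  then have q12: "l1^2 + l1*l2 + l2^2 + A*(l1 + l2) + B = 0"
    using d by simp
  have "(l1 - l3) * (l1^2 + l1*l3 + l3^2 + A*(l1 + l3) + B) = 0"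
    using r1 r3 by (simp add: algebra_simps power2_eq_square power3_eq_cube)
  then have q13: "l1^2 + l1*l3 + l3^2 + A*(l1 + l3) + B = 0"
    using d by simp
  have "(l2 - l3) * (l1 + l2 + l3 + A) = 0"
    using q12 q13 by (simp add: algebra_simps power2_eq_square)
  then have A: "A = - (l1 + l2 + l3)"
    using d by simp
  have B: "B = l1*l2 + l1*l3 + l2*l3"
    using q12 by (simp add: A algebra_simps power2_eq_square)
  have C: "C = - (l1*l2*l3)"
    using r1 by (simp add: A B algebra_simps power2_eq_square power3_eq_cube)
  show ?thesis
    by (simp add: A B C algebra_simps power2_eq_square power3_eq_cube)
qed

lemma monic_cubic_three_real_roots:
  fixes A B C t :: real
  defines "p \<equiv> \<lambda>z. z^3 + A*z^2 + B*z + C"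
  assumes "t > 0" "p (-t) > 0" "p 0 < 0" "p t < 0"
  shows "\<exists>l1 l2 l3. l1 < -t \<and> -t < l2 \<and> l2 < 0 \<and> t < l3 \<and>
           (\<forall>z. p z = (z - l1) * (z - l2) * (z - l3))"
proof -
  have "\<forall>\<^sub>F K in at_top. p (-K) < 0 \<and> 0 < p K \<and> t \<le> K"
  proof (intro eventually_conj)
    have "filterlim (\<lambda>K. p (-K)) at_bot at_top"
      unfolding p_def by real_asymp
    then show "\<forall>\<^sub>F K in at_top. p (-K) < 0"
      by (simp add: filterlim_at_bot_dense)
    have "filterlim p at_top at_top"
      unfolding p_def by real_asymp
    then show "\<forall>\<^sub>F K in at_top. 0 < p K"
      by (simp add: filterlim_at_top_dense)
  qed (rule eventually_ge_at_top)
  then obtain K where K: "p (-K) < 0" "0 < p K" "t \<le> K"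
    using eventually_happens'[OF trivial_limit_at_top_linorder] by blast
  have cont: "continuous_on S p" for S
    unfolding p_def by (intro continuous_intros)
  obtain l1 where l1: "-K \<le> l1" "l1 \<le> -t" "p l1 = 0"
    using IVT'[of p "-K" 0 "-t"] K assms(3) cont by auto
  obtain l2 where l2: "-t \<le> l2" "l2 \<le> 0" "p l2 = 0"
    using IVT2'[of p 0 0 "-t"] assms(2-4) cont by auto
  obtain l3 where l3: "t \<le> l3" "l3 \<le> K" "p l3 = 0"
    using IVT'[of p t 0 K] K assms(5) cont by auto
  have "l1 \<noteq> -t" "l2 \<noteq> -t" "l2 \<noteq> 0" "l3 \<noteq> t"
    using l1(3) l2(3) l3(3) assms(3-5) by auto
  then have strict: "l1 < -t" "-t < l2" "l2 < 0" "t < l3"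
    using l1 l2 l3 by auto
  then have "p z = (z - l1) * (z - l2) * (z - l3)" for z
    using monic_cubic_eq_prod_of_roots[of l1 A B C l2 l3 z] l1(3) l2(3) l3(3) strict
    unfolding p_def by simp
  with strict show ?thesis
    by blast
qed

definition saddle_equilibrium :: "(real^3 \<Rightarrow> real^3) \<Rightarrow> real^3 \<Rightarrow> bool" where
  "saddle_equilibrium F X \<longleftrightarrow> F X = 0 \<and>
     (\<exists>L. (F has_derivative L) (at X) \<and>
        dim (stable_subspace L) = 2 \<and> dim (unstable_subspace L) = 1 \<and>
        (\<exists>l1 l2 l3 :: real. l1 < l2 \<and> l2 < 0 \<and> 0 < l3 \<and> - l2 < l3 \<and>
           (\<forall>z::real. det (mat z - matrix L) = (z - l1) * (z - l2) * (z - l3))))"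

lemma saddle_equilibriumI:
  fixes A :: "real^3^3"
  assumes "F X = 0" "(F has_derivative (*v) A) (at X)"
    and "\<And>z. det (mat z - A) = (z - l1) * (z - l2) * (z - l3)"
    and "l1 < l2" "l2 < 0" "0 < l3" "- l2 < l3"
  shows "saddle_equilibrium F X"
  unfolding saddle_equilibrium_def
  using assms dim_stable_unstable_subspace_of_spectrum[OF assms(3-6)]
  by (intro conjI exI[of _ "(*v) A"] exI[of _ l1] exI[of _ l2] exI[of _ l3]) auto

text \<open>The linearisation of q' = s, s' = a q + m s - b u, u' = al q + be u.  At an equilibrium
  (q, 0, u) of the Barkley field, where g vanishes, a = - f_q / D, m = (u + mu) / D,
  b = f_u / D = q / D, al = eps g_q / (u - c) and be = eps g_u / (u - c).\<close>

definition slow_fast_jacobian :: "real \<Rightarrow> real \<Rightarrow> real \<Rightarrow> real \<Rightarrow> real \<Rightarrow> real^3^3" where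
  "slow_fast_jacobian a m b al be = vector [vector [0, 1, 0], vector [a, m, - b], vector [al, 0, be]]"

lemma slow_fast_jacobian_mult:
  "slow_fast_jacobian a m b al be *v h =
     vec3 (h$2) (a * h$1 + m * h$2 - b * h$3) (al * h$1 + be * h$3)"
  by (simp add: slow_fast_jacobian_def vec3_def vec_eq_iff forall_3 matrix_vector_mult_def sum_3)

lemma det_slow_fast_jacobian:
  "det (mat z - slow_fast_jacobian a m b al be) = (z - be) * (z^2 - m*z - a) + b * al"
  by (simp add: det_3 slow_fast_jacobian_def mat_def algebra_simps power2_eq_square)

lemma slow_fast_jacobian_saddle_spectrum:
  assumes "t > 0" "(- t - be) * (t^2 + m*t - a) + b * al > 0" "a * be + b * al < 0"
    "(t - be) * (t^2 - m*t - a) + b * al < 0"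
  shows "\<exists>l1 l2 l3. l1 < l2 \<and> l2 < 0 \<and> 0 < l3 \<and> - l2 < l3 \<and>
    (\<forall>z. det (mat z - slow_fast_jacobian a m b al be) = (z - l1) * (z - l2) * (z - l3))"
proof -
  have charpoly: "det (mat z - slow_fast_jacobian a m b al be) =
      z^3 + (- (m + be)) * z^2 + (m * be - a) * z + (a * be + b * al)" for z
    by (simp add: det_slow_fast_jacobian algebra_simps power2_eq_square power3_eq_cube)
  obtain l1 l2 l3 where "l1 < -t" "-t < l2" "l2 < 0" "t < l3"
    and "\<forall>z. z^3 + (- (m + be)) * z^2 + (m * be - a) * z + (a * be + b * al) = (z - l1) * (z - l2) * (z - l3)"
    using monic_cubic_three_real_roots[of t "- (m + be)" "m * be - a" "a * be + b * al"] assms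
    by (auto simp: algebra_simps power2_eq_square power3_eq_cube)
  then show ?thesis
    by (intro exI[of _ l1] exI[of _ l2] exI[of _ l3]) (auto simp: charpoly)
qed

lemma vec_nth_has_derivative [derivative_intros]: "((\<lambda>X. X $ i) has_derivative (\<lambda>h. h $ i)) F"
  using bounded_linear_imp_has_derivative[OF bounded_linear_vec_nth] .

lemma vec3_nth [simp]: "vec3 x y z $ 1 = x" "vec3 x y z $ 2 = y" "vec3 x y z $ 3 = z"
  by (simp_all add: vec3_def)

lemma vec3_has_derivative:
  assumes "(F1 has_derivative L1) (at X)" "(F2 has_derivative L2) (at X)" "(F3 has_derivative L3) (at X)"
  shows "((\<lambda>Y. vec3 (F1 Y) (F2 Y) (F3 Y)) has_derivative (\<lambda>h. vec3 (L1 h) (L2 h) (L3 h))) (at X)"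
proof -
  have vec3_axis: "vec3 x y z = x *\<^sub>R axis 1 1 + y *\<^sub>R axis 2 1 + z *\<^sub>R axis 3 1" for x y z
    by (simp add: vec3_def vec_eq_iff forall_3 axis_def)
  show ?thesis
    unfolding vec3_axis by (intro derivative_intros assms)
qed

lemma barkley_field_has_derivative:
  assumes g: "g_B q u = 0" and "u \<noteq> c" "D \<noteq> 0"
  shows "(barkley_field r D mu c eps has_derivative (*v) (slow_fast_jacobian
      (- (r + u - 2 - (r + 0.1) * (q - 1)^2 - 2 * (r + 0.1) * q * (q - 1)) / D) ((u + mu) / D) (q / D)
      (eps / (u - c) * (2 * (1 - u))) (eps / (u - c) * (- 1 - 2 * q))))
    (at (vec3 q 0 u))"
proof -
  have s: "((\<lambda>X. ((X$3 + mu) * X$2 - f_B (X$1) (X$3) r) / D) has_derivative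
      (\<lambda>h. - (r + u - 2 - (r + 0.1) * (q - 1)^2 - 2 * (r + 0.1) * q * (q - 1)) / D * h$1
           + (u + mu) / D * h$2 - q / D * h$3)) (at (vec3 q 0 u))"
    unfolding f_B_def
    by (rule has_derivative_eq_rhs, (rule derivative_eq_intros refl | simp add: assms(3))+)
      (use assms(3) in \<open>auto simp: fun_eq_iff field_simps power2_eq_square\<close>)
  have prefactor: "((\<lambda>X. eps / (X$3 - c)) has_derivative (\<lambda>h. - (eps * h$3) / (u - c)^2))
      (at (vec3 q 0 u))"
    by (rule has_derivative_eq_rhs, (rule derivative_eq_intros refl | simp add: assms(2))+)
      (simp add: fun_eq_iff power2_eq_square)
  have "((\<lambda>X. g_B (X$1) (X$3)) has_derivative (\<lambda>h. 2 * (1 - u) * h$1 + (- 1 - 2 * q) * h$3))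
      (at (vec3 q 0 u))"
    unfolding g_B_def
    by (rule has_derivative_eq_rhs, (rule derivative_eq_intros refl)+) (auto simp: fun_eq_iff algebra_simps)
  \<comment> \<open>g vanishes at the equilibrium, so the derivative of the prefactor drops out\<close>
  from has_derivative_mult[OF prefactor this]
  have "((\<lambda>X. eps / (X$3 - c) * g_B (X$1) (X$3)) has_derivative
      (\<lambda>h. eps / (u - c) * (2 * (1 - u)) * h$1 + eps / (u - c) * (- 1 - 2 * q) * h$3)) (at (vec3 q 0 u))"
    using g by (simp add: algebra_simps)
  from vec3_has_derivative[OF vec_nth_has_derivative s this] show ?thesis
    unfolding barkley_field_def slow_fast_jacobian_mult by simp
qed

lemma slow_fast_jacobian_eventually_saddle_spectrum:
  assumes a: "0 < a" and b: "0 \<le> b" and al: "al < 0" and be: "be < 0"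
  shows "\<forall>\<^sub>F eps in at_right 0. \<exists>l1 l2 l3. l1 < l2 \<and> l2 < 0 \<and> 0 < l3 \<and> - l2 < l3 \<and>
    (\<forall>z. det (mat z - slow_fast_jacobian a m b (eps * al) (eps * be)) = (z - l1) * (z - l2) * (z - l3))"
proof -
  have "((\<lambda>t. t^2 + \<bar>m\<bar> * t) \<longlongrightarrow> 0) (at_right 0)"
    by real_asymp
  from eventually_conj[OF eventually_at_right_less order_tendstoD(2)[OF this a]]
  obtain t where t: "0 < t" "t^2 + \<bar>m\<bar> * t < a"
    using eventually_happens'[OF trivial_limit_at_right_real] by blast
  have "m * t \<le> \<bar>m\<bar> * t" "- m * t \<le> \<bar>m\<bar> * t"
    using t(1) mult_right_mono[of "- m" "\<bar>m\<bar>" t] by (simp_all add: mult_right_mono)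
  then have quadratic_neg: "t^2 + m * t - a < 0" "t^2 - m * t - a < 0"
    using t(2) by linarith+
  have "\<forall>\<^sub>F eps in at_right 0. 0 < (- t - eps * be) * (t^2 + m * t - a) + b * (eps * al)"
  proof (rule order_tendstoD(1))
    show "((\<lambda>eps. (- t - eps * be) * (t^2 + m * t - a) + b * (eps * al)) \<longlongrightarrow>
        (- t - 0 * be) * (t^2 + m * t - a) + b * (0 * al)) (at_right 0)"
      by (intro tendsto_intros)
    show "0 < (- t - 0 * be) * (t^2 + m * t - a) + b * (0 * al)"
      using t(1) quadratic_neg(1) by (simp add: mult_pos_neg)
  qed
  moreover have "\<forall>\<^sub>F eps in at_right 0. (t - eps * be) * (t^2 - m * t - a) + b * (eps * al) < 0"
  proof (rule order_tendstoD(2))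
    show "((\<lambda>eps. (t - eps * be) * (t^2 - m * t - a) + b * (eps * al)) \<longlongrightarrow>
        (t - 0 * be) * (t^2 - m * t - a) + b * (0 * al)) (at_right 0)"
      by (intro tendsto_intros)
    show "(t - 0 * be) * (t^2 - m * t - a) + b * (0 * al) < 0"
      using t(1) quadratic_neg(2) by (simp add: mult_pos_neg)
  qed
  moreover have "\<forall>\<^sub>F eps in at_right 0. a * (eps * be) + b * (eps * al) < 0"
    using eventually_at_right_less
  proof eventually_elim
    case (elim eps)
    then show ?case
      using a b al be by (simp add: mult_pos_neg mult_nonneg_nonpos add_neg_nonpos)
  qed
  ultimately show ?thesis
    by eventually_elim (rule slow_fast_jacobian_saddle_spectrum[OF t(1)])
qed

lemma barkley_equilibrium_eventually_saddle:
  assumes f: "f_B q u r = 0" and g: "g_B q u = 0" and u: "1 < u" "c < u" and q: "0 \<le> q" and D: "0 < D"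
    and f_q: "r + u - 2 - (r + 0.1) * (q - 1)^2 - 2 * (r + 0.1) * q * (q - 1) < 0"
  shows "\<forall>\<^sub>F eps in at_right 0. saddle_equilibrium (barkley_field r D mu c eps) (vec3 q 0 u)"
proof -
  define a where "a = - (r + u - 2 - (r + 0.1) * (q - 1)^2 - 2 * (r + 0.1) * q * (q - 1)) / D"
  define m where "m = (u + mu) / D"
  define b where "b = q / D"
  define al where "al = 2 * (1 - u) / (u - c)"
  define be where "be = (- 1 - 2 * q) / (u - c)"
  have "0 < a" "0 \<le> b" "al < 0" "be < 0"
    using f_q D q u by (simp_all add: a_def b_def al_def be_def divide_neg_pos)
  from slow_fast_jacobian_eventually_saddle_spectrum[OF this, of m]
  show ?thesis
  proof eventually_elim
    case (elim eps)
    then obtain l1 l2 l3 where l: "l1 < l2" "l2 < 0" "0 < l3" "- l2 < l3"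
      and charpoly: "\<forall>z. det (mat z - slow_fast_jacobian a m b (eps * al) (eps * be)) =
                         (z - l1) * (z - l2) * (z - l3)"
      by blast
    have "barkley_field r D mu c eps (vec3 q 0 u) = 0"
      using f g by (simp add: barkley_field_def vec3_def vec_eq_iff)
    moreover have "(barkley_field r D mu c eps has_derivative
        (*v) (slow_fast_jacobian a m b (eps * al) (eps * be))) (at (vec3 q 0 u))"
      using barkley_field_has_derivative[OF g, of c D r mu eps] u D
      by (simp add: a_def m_def b_def al_def be_def)
    ultimately show ?case
      using saddle_equilibriumI charpoly l by blast
  qed
qed

lemma g_B_qplus_neg_above_root:
  assumes r: "0 < r + 0.1" and u: "1 < u1" "u1 < u2" "u1 < 2" and root: "g_B (qplus r u1) u1 = 0"
  shows "g_B (qplus r u2) u2 < 0"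
proof -
  have "qplus r u1 * (2 * (u1 - 1)) = 2 - u1"
    using root by (simp add: g_B_def algebra_simps)
  then have "0 < qplus r u1 * (2 * (u1 - 1))"
    using u(3) by simp
  then have "0 < qplus r u1"
    using u(1) by (simp add: zero_less_mult_iff)
  moreover have "qplus r u1 \<le> qplus r u2"
    unfolding qplus_def using r u by (auto intro!: real_sqrt_le_mono divide_right_mono)
  ultimately have "qplus r u1 * (u1 - 1) < qplus r u2 * (u2 - 1)"
    using u by (intro mult_le_less_imp_less) auto
  then show ?thesis
    using root u by (simp add: g_B_def algebra_simps)
qed

lemma u_b_ex1:
  assumes r: "2/3 < r"
  shows "\<exists>!u. 6/5 < u \<and> u < 4/3 \<and> g_B (qplus r u) u = 0"
proof (rule ex_ex1I)
  define h where "h u = g_B (qplus r u) u" for u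
  have "continuous_on {6/5..4/3} h"
    unfolding h_def g_B_def qplus_def using r by (intro continuous_intros) auto
  moreover have "0 < h (6/5)"
    using r by (simp add: h_def g_B_def qplus_def divide_less_eq)
  moreover have "h (4/3) < 0"
    using r by (simp add: h_def g_B_def qplus_def divide_pos_pos)
  ultimately obtain u where "6/5 \<le> u" "u \<le> 4/3" "h u = 0"
    using IVT2'[of h "4/3" 0 "6/5"] by force
  moreover from this have "u \<noteq> 6/5" "u \<noteq> 4/3"
    using \<open>0 < h (6/5)\<close> \<open>h (4/3) < 0\<close> by (metis less_irrefl)+
  ultimately show "\<exists>u. 6/5 < u \<and> u < 4/3 \<and> g_B (qplus r u) u = 0"
    unfolding h_def by (intro exI[of _ u]) auto
next
  fix u v
  assume "6/5 < u \<and> u < 4/3 \<and> g_B (qplus r u) u = 0" "6/5 < v \<and> v < 4/3 \<and> g_B (qplus r v) v = 0"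
  then show "u = v"
    using g_B_qplus_neg_above_root[of r u v] g_B_qplus_neg_above_root[of r v u] r
    by (cases u v rule: linorder_cases) auto
qed

lemma u_b_bounds_root:
  assumes "2/3 < r"
  shows "6/5 < u_b r" "u_b r < 4/3" "g_B (q_bp r) (u_b r) = 0"
  using theI'[OF u_b_ex1[OF assms]] unfolding u_b_def q_bp_def by auto

lemma q_bp_gt_1:
  assumes "2/3 < r"
  shows "1 < q_bp r"
proof -
  have "q_bp r * (2 * (u_b r - 1)) = 2 - u_b r"
    using u_b_bounds_root[OF assms] by (simp add: g_B_def algebra_simps)
  moreover have "1 * (2 * (u_b r - 1)) < 2 - u_b r"
    using u_b_bounds_root[OF assms] by simp
  ultimately have "1 * (2 * (u_b r - 1)) < q_bp r * (2 * (u_b r - 1))"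
    by linarith
  then show ?thesis
    by (rule mult_right_less_imp_less) (use u_b_bounds_root[OF assms] in simp)
qed

lemma q_bp_on_nontrivial_branch:
  assumes "2/3 < r"
  shows "r + u_b r - 2 - (r + 0.1) * (q_bp r - 1)^2 = 0"
proof -
  define w where "w = (r + u_b r - 2) / (r + 0.1)"
  have "q_bp r = 1 + sqrt w"
    by (simp add: q_bp_def qplus_def w_def)
  then have "0 < w" "(q_bp r - 1)^2 = w"
    using q_bp_gt_1[OF assms] by auto
  then show ?thesis
    using assms by (simp add: w_def)
qed

theorem corollary1:
  fixes r D mu c :: real
  assumes "r > 2/3" and "D > 0" and "c < u_b r"
  shows "\<exists>eps0>0. \<forall>eps. 0 < eps \<and> eps < eps0 \<longrightarrow>
           (\<forall>X \<in> {X1, X2 r}.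
              barkley_field r D mu c eps X = 0 \<and>
              (\<exists>L. (barkley_field r D mu c eps has_derivative L) (at X) \<and>
                   dim (stable_subspace L) = 2 \<and> dim (unstable_subspace L) = 1 \<and>
                   (\<exists>l1 l2 l3 :: real. l1 < l2 \<and> l2 < 0 \<and> 0 < l3 \<and> - l2 < l3 \<and>
                      (\<forall>z::real. det (mat z - matrix L) = (z - l1) * (z - l2) * (z - l3)))))"
proof -
  note u_b = u_b_bounds_root[OF assms(1)] and q_bp = q_bp_gt_1[OF assms(1)] q_bp_on_nontrivial_branch[OF assms(1)]
  have "\<forall>\<^sub>F eps in at_right 0. saddle_equilibrium (barkley_field r D mu c eps) X1"
    unfolding X1_def using assms u_b
    by (intro barkley_equilibrium_eventually_saddle) (auto simp: f_B_def g_B_def)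
  moreover have "\<forall>\<^sub>F eps in at_right 0. saddle_equilibrium (barkley_field r D mu c eps) (X2 r)"
    unfolding X2_def using assms u_b q_bp
    by (intro barkley_equilibrium_eventually_saddle) (auto simp: f_B_def)
  ultimately have "\<forall>\<^sub>F eps in at_right 0. \<forall>X \<in> {X1, X2 r}. saddle_equilibrium (barkley_field r D mu c eps) X"
    by eventually_elim simp
  then show ?thesis
    unfolding eventually_at_right_field saddle_equilibrium_def by auto
qed

end
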